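(* Let $u_0,u_1,\sigma_0,\sigma_1\in\mathbb{R}$ be constants with $u_1\neq0$. For $t\in[0,\infty)$, the Cauchy problem $$u_t+uu_x-\sigma_x=0,\qquad \sigma_t+u\sigma_x=0,$$ $$u(x,0)=u_0+u_1H(-x),\qquad \sigma(x,0)=\sigma_0+\sigma_1H(-x),$$ has a generalised delta-shock wave type solution of the form $$u(x,t)=u_0+u_1H(-x+\phi(t)),\qquad \sigma(x,t)=\sigma_0+\sigma_1H(-x+\phi(t))+e(t)\,\delta(x-\phi(t)),$$ with $\phi(t)$ and $e(t)$ given by $$\phi(t)=\frac{[\frac{u^2}{2}]-[\sigma]}{[u]}\,t,\qquad e(t)=\frac{[\sigma]^2}{[u]}\,t.$$
   Context: $H$ is the Heaviside function, $\delta$ the Dirac delta, $\mathcal{D}(\mathbb{R}\times[0,\infty))$ the smooth compactly supported functions on $\mathbb{R}\times[0,\infty)$. The jump of a function $v$ across the discontinuity is $[v]=v_L-v_R$ (left value minus right value); here $[u]=u_1$, $[\sigma]=\sigma_1$ (jump of the regular part of $\sigma$), $[\frac{u^2}{2}]=\frac{(u_0+u_1)^2}{2}-\frac{u_0^2}{2}$. Definition (generalised delta-shock wave type solution). Let $u\in BV(\mathbb{R}\times(0,\infty);\mathbb{R})$ and $\sigma(x,t)=\tilde\sigma(x,t)+e(x,t)\delta(x-\phi(t))$, where $\tilde\sigma\in BV(\mathbb{R}\times(0,\infty);\mathbb{R})$ and $e$ is a smooth function ($BV$ is understood as locally of bounded variation). The pair $(u,\sigma)$ is a generalised delta-shock wave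 type solution of the system with initial conditions $u(0)$ and $\sigma(0)=\sigma_0+\sigma_1H(-x)$ if for all $\theta\in\mathcal{D}(\mathbb{R}\times[0,\infty))$: $$\int_0^\infty\!\!\int_{\mathbb{R}}\Big(u\theta_t+\big(\tfrac{u^2}{2}-\tilde\sigma\big)\theta_x\Big)dx\,dt+\int_{\mathbb{R}}u(0)\,\theta(x,0)\,dx=0,$$ $$\int_0^\infty\!\!\int_{\mathbb{R}}(\tilde\sigma_t+\hat u\,\tilde\sigma_x)\,\theta\,dx\,dt-\int_\Gamma e(x,t)\frac{\partial\theta(x,t)}{\partial l}\,dl=0.$$ Here $\tilde\sigma_t,\tilde\sigma_x$ are measures (distributional derivatives), $\hat u(x)=\int_0^1\big(u(x-)+\tau(u(x+)-u(x-))\big)d\tau$ (at each fixed $t$), $\Gamma=\{(x,t):x=\phi(t)\}$, and $\frac{\partial\theta}{\partial l}$ is the tangential derivative along $\Gamma$, so that $\int_\Gamma e\,\frac{\partial\theta}{\partial l}\,dl=\int_0^\infty e(\phi(t),t)\,\frac{d}{dt}\theta(\phi(t),t)\,dt$. *)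

theory Defs
  imports "HOL-Analysis.Analysis"
begin

text \<open>Points of the plane are pairs \<open>(x, t)\<close>: space first, time second.\<close>

definition half_plane :: "(real \<times> real) set" where
  "half_plane = UNIV \<times> {0<..}"

definition closed_half_plane :: "(real \<times> real) set" where
  "closed_half_plane = UNIV \<times> {0..}"

text \<open>
  The value at \<open>0\<close> is a convention; it only changes functions on null sets.
\<close>
definition heaviside :: "real \<Rightarrow> real" where
  "heaviside x = (if 0 \<le> x then 1 else 0)"

definition jump :: "real \<Rightarrow> real \<Rightarrow> real" where
  "jump v_left v_right = v_left - v_right"


section \<open>Test functions\<close>

text \<open>
  Derivatives are taken relative to \<open>S\<close>, hence one-sided in time on the line \<open>t = 0\<close> when \<open>S\<close>
  is the closed half plane. Values outside \<open>S\<close> are irrelevant throughout.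
\<close>

definition partial :: "(real \<times> real) set \<Rightarrow> real \<times> real \<Rightarrow> (real \<times> real \<Rightarrow> real) \<Rightarrow> real \<times> real \<Rightarrow> real" where
  "partial S d f z = frechet_derivative f (at z within S) d"

abbreviation "partial_x S \<equiv> partial S (1, 0)"
abbreviation "partial_t S \<equiv> partial S (0, 1)"

primrec Ck_on :: "nat \<Rightarrow> (real \<times> real) set \<Rightarrow> (real \<times> real \<Rightarrow> real) \<Rightarrow> bool" where
  "Ck_on 0 S f \<longleftrightarrow> continuous_on S f"
| "Ck_on (Suc k) S f \<longleftrightarrow>
     f differentiable_on S \<and> Ck_on k S (partial_x S f) \<and> Ck_on k S (partial_t S f)"

definition smooth_on :: "(real \<times> real) set \<Rightarrow> (real \<times> real \<Rightarrow> real) \<Rightarrow> bool" where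
  "smooth_on S f \<longleftrightarrow> (\<forall>k. Ck_on k S f)"

definition test_functions :: "(real \<times> real) set \<Rightarrow> (real \<times> real \<Rightarrow> real) set" where
  "test_functions S =
     {f. smooth_on S f \<and> (\<exists>K. compact K \<and> K \<subseteq> S \<and> (\<forall>z \<in> S - K. f z = 0))}"


section \<open>Functions of locally bounded variation\<close>

text \<open>
  A signed Radon measure on the half plane is a pair \<open>(P, N)\<close> of positive Borel measures standing
  for \<open>P - N\<close>. A pair is used because \<open>P\<close> and \<open>N\<close> may both have infinite total mass. Local
  finiteness is required up to \<open>t = 0\<close>, because the weak formulation below integrates test
  functions that do not vanish there.
\<close>

type_synonym signed_measure = "(real \<times> real) measure \<times> (real \<times> real) measure"

definition locally_finite :: "(real \<times> real) measure \<Rightarrow> bool" where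
  "locally_finite M \<longleftrightarrow>
     sets M = sets borel \<and> (\<forall>K. compact K \<longrightarrow> emeasure M (half_plane \<inter> K) < \<infinity>)"

definition signed_radon :: "signed_measure \<Rightarrow> bool" where
  "signed_radon M \<longleftrightarrow> locally_finite (fst M) \<and> locally_finite (snd M)"

definition signed_integrable :: "signed_measure \<Rightarrow> (real \<times> real \<Rightarrow> real) \<Rightarrow> bool" where
  "signed_integrable M f \<longleftrightarrow>
     set_integrable (fst M) half_plane f \<and> set_integrable (snd M) half_plane f"

definition signed_integral :: "signed_measure \<Rightarrow> (real \<times> real \<Rightarrow> real) \<Rightarrow> real" where
  "signed_integral M f = (LINT z:half_plane|fst M. f z) - (LINT z:half_plane|snd M. f z)"

definition signed_AE :: "signed_measure \<Rightarrow> (real \<times> real \<Rightarrow> bool) \<Rightarrow> bool" where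
  "signed_AE M P \<longleftrightarrow>
     (AE z in fst M. z \<in> half_plane \<longrightarrow> P z) \<and> (AE z in snd M. z \<in> half_plane \<longrightarrow> P z)"

definition loc_integrable :: "(real \<times> real \<Rightarrow> real) \<Rightarrow> bool" where
  "loc_integrable v \<longleftrightarrow> (\<forall>K. compact K \<longrightarrow> set_integrable lborel (half_plane \<inter> K) v)"

text \<open>\<open>M\<close> is the distributional derivative of \<open>v\<close> in direction \<open>d\<close> on the open half plane.\<close>
definition derivative_measure ::
    "real \<times> real \<Rightarrow> (real \<times> real \<Rightarrow> real) \<Rightarrow> signed_measure \<Rightarrow> bool" where
  "derivative_measure d v M \<longleftrightarrow> signed_radon M \<and>
     (\<forall>\<psi> \<in> test_functions half_plane.
        (LINT z:half_plane|lborel. v z * partial half_plane d \<psi> z) = - signed_integral M \<psi>)"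

abbreviation "is_measure_x \<equiv> derivative_measure (1, 0)"
abbreviation "is_measure_t \<equiv> derivative_measure (0, 1)"

definition BV_loc :: "(real \<times> real \<Rightarrow> real) \<Rightarrow> bool" where
  "BV_loc v \<longleftrightarrow> loc_integrable v \<and> (\<exists>Mx. is_measure_x v Mx) \<and> (\<exists>Mt. is_measure_t v Mt)"


section \<open>Generalised delta-shock wave type solutions\<close>

definition has_side_limits :: "(real \<times> real \<Rightarrow> real) \<Rightarrow> real \<times> real \<Rightarrow> bool" where
  "has_side_limits u z \<longleftrightarrow>
     (\<exists>l. ((\<lambda>y. u (y, snd z)) \<longlongrightarrow> l) (at_left (fst z))) \<and>
     (\<exists>r. ((\<lambda>y. u (y, snd z)) \<longlongrightarrow> r) (at_right (fst z)))"

definition hat :: "(real \<times> real \<Rightarrow> real) \<Rightarrow> real \<times> real \<Rightarrow> real" where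
  "hat u z =
     (let l = Lim (at_left (fst z)) (\<lambda>y. u (y, snd z));
          r = Lim (at_right (fst z)) (\<lambda>y. u (y, snd z))
      in integral {0..1} (\<lambda>\<tau>. l + \<tau> * (r - l)))"

definition C1_curve :: "(real \<Rightarrow> real) \<Rightarrow> bool" where
  "C1_curve \<phi> \<longleftrightarrow>
     (\<exists>\<phi>'. continuous_on {0..} \<phi>' \<and>
        (\<forall>t\<ge>0. (\<phi> has_real_derivative \<phi>' t) (at t within {0..})))"

definition along :: "(real \<Rightarrow> real) \<Rightarrow> (real \<times> real \<Rightarrow> real) \<Rightarrow> real \<Rightarrow> real" where
  "along \<phi> f t = f (\<phi> t, t)"

text \<open>
  Weak form of \<open>u\<^sub>t + u u\<^sub>x - \<sigma>\<^sub>x = 0\<close>, \<open>\<sigma>\<^sub>t + u \<sigma>\<^sub>x = 0\<close> for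
  \<open>\<sigma> = s + e \<delta>(x - \<phi>(t))\<close>, where \<open>\<sigma>\<close> is given by its regular part \<open>s\<close>, the amplitude \<open>e\<close> and the
  curve \<open>\<phi>\<close>; \<open>u_init\<close> is the initial datum of \<open>u\<close>. The weak form does not involve the initial
  datum of \<open>\<sigma>\<close>. Integrability and existence of one-sided limits are stated because
  the integrals and \<open>hat\<close> are total functions. Since \<open>Mx\<close> and \<open>Mt\<close> are determined by \<open>s\<close> up to
  the choice of the representing pair, quantifying over them existentially is harmless.
\<close>
definition delta_shock_solution ::
    "(real \<times> real \<Rightarrow> real) \<Rightarrow> (real \<times> real \<Rightarrow> real) \<Rightarrow> (real \<times> real \<Rightarrow> real) \<Rightarrow> (real \<Rightarrow> real) \<Rightarrow>
     (real \<Rightarrow> real) \<Rightarrow> bool" where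
  "delta_shock_solution u s e \<phi> u_init \<longleftrightarrow>
     BV_loc u \<and> BV_loc s \<and> smooth_on closed_half_plane e \<and> C1_curve \<phi> \<and>
     (\<forall>\<theta> \<in> test_functions closed_half_plane.
        set_integrable lborel half_plane
          (\<lambda>z. u z * partial_t closed_half_plane \<theta> z
             + ((u z)\<^sup>2 / 2 - s z) * partial_x closed_half_plane \<theta> z) \<and>
        integrable lborel (\<lambda>x. u_init x * \<theta> (x, 0)) \<and>
        (LINT z:half_plane|lborel.
            u z * partial_t closed_half_plane \<theta> z
             + ((u z)\<^sup>2 / 2 - s z) * partial_x closed_half_plane \<theta> z)
          + (LINT x|lborel. u_init x * \<theta> (x, 0)) = 0) \<and>
     (\<exists>Mx Mt. is_measure_x s Mx \<and> is_measure_t s Mt \<and>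
        signed_AE Mx (has_side_limits u) \<and>
        (\<forall>\<theta> \<in> test_functions closed_half_plane.
           signed_integrable Mt \<theta> \<and>
           signed_integrable Mx (\<lambda>z. hat u z * \<theta> z) \<and>
           set_integrable lborel {0<..} (\<lambda>t. along \<phi> e t * deriv (along \<phi> \<theta>) t) \<and>
           signed_integral Mt \<theta> + signed_integral Mx (\<lambda>z. hat u z * \<theta> z)
             - (LINT t:{0<..}|lborel. along \<phi> e t * deriv (along \<phi> \<theta>) t) = 0))"

end

theory Submission
  imports Defs
begin

text \<open>
  Write \<open>H\<close> for the Heaviside function, \<open>c\<close> for the speed of the shock and \<open>k\<close> for the growth rate
  of the amplitude, so that \<open>\<phi>(t) = c t\<close> and \<open>e(t) = k t\<close>. Both \<open>u\<close> and \<open>s\<close> are affine functions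
  of the same travelling step \<open>H(c t - x)\<close>, which has two consequences.

  First equation. The Rankine-Hugoniot value of \<open>c\<close> is the one for which the flux
  \<open>u\<^sup>2 / 2 - s\<close> equals \<open>c u\<close> plus a constant \<open>m\<close>. The space-time integrand is therefore
  \<open>u (\<theta>\<^sub>t + c \<theta>\<^sub>x) + m \<theta>\<^sub>x\<close>. The second term integrates to zero. In the first, \<open>\<theta>\<^sub>t + c \<theta>\<^sub>x\<close> is
  the derivative of \<open>\<theta>\<close> along the lines \<open>x - c t = const\<close>, on each of which \<open>u\<close> is constant, so
  the integral over such a line is minus that constant times the initial value of \<open>\<theta>\<close>
  (\<open>integral_step_transport\<close>), which the initial term of the weak form compensates.

  Second equation. Integrating \<open>\<theta>\<^sub>x\<close> over \<open>x \<le> c t\<close> leaves \<open>\<theta>(c t, t)\<close> (\<open>integral_step_x\<close>).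
  Hence \<open>s\<^sub>x\<close> and \<open>s\<^sub>t\<close> are \<open>- s1\<close> and \<open>c s1\<close> times the measure \<open>dt\<close> carried by the shock line
  (\<open>step_derivative_measures\<close>). On that line the averaged velocity is \<open>u0 + u1 / 2\<close>, so with
  \<open>I = \<integral> \<theta>(c t, t) dt\<close> the measure terms contribute \<open>s1 (c - u0 - u1 / 2) I\<close>, and
  \<open>c - u0 - u1 / 2 = - s1 / u1\<close>. Thus the velocity average does not match the shock speed and
  the defect is \<open>- (s1\<^sup>2 / u1) I\<close>. Integration by parts in time turns the delta term into
  \<open>- \<integral> k t (d/dt) \<theta>(c t, t) dt = k I\<close> (\<open>integral_time_weighted\<close>), which cancels the defect
  exactly for \<open>k = s1\<^sup>2 / u1\<close>.

  All integrals over the half plane are computed after the shear \<open>(y, t) \<mapsto> (y + c t, t)\<close>,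
  which preserves Lebesgue measure and makes the shock vertical. Fubini's theorem and the
  fundamental theorem of calculus then suffice.
\<close>


section \<open>Compactly supported functions on the closed half plane\<close>

lemma mem_half_planes [simp]:
  "(x, t) \<in> half_plane \<longleftrightarrow> 0 < t" "(x, t) \<in> closed_half_plane \<longleftrightarrow> 0 \<le> t"
  by (auto simp: half_plane_def closed_half_plane_def)

lemma half_plane_subset: "half_plane \<subseteq> closed_half_plane"
  by (auto simp: half_plane_def closed_half_plane_def)

lemma open_half_plane: "open half_plane"
  unfolding half_plane_def by (intro open_Times) auto

lemma sets_half_plane [measurable]: "half_plane \<in> sets borel"
  using open_half_plane by (rule borel_open)

text \<open>
  The support may touch the line \<open>t = 0\<close>, and only values on the closed half plane count. The
  support condition is stated through boundedness, which survives linear changes of variables.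
\<close>
definition C0c :: "(real \<times> real \<Rightarrow> real) \<Rightarrow> bool" where
  "C0c f \<longleftrightarrow> continuous_on closed_half_plane f \<and> bounded {z \<in> closed_half_plane. f z \<noteq> 0}"

text \<open>
  The data \<open>(\<theta>, \<theta>\<^sub>x, \<theta>\<^sub>t)\<close> of a compactly supported \<open>C\<^sup>1\<close> function. Carrying the partial
  derivatives as separate functions lets the two classes of test functions, on the open and on
  the closed half plane, be treated alike although their derivatives are taken relative to
  different sets.
\<close>
definition C1c ::
    "(real \<times> real \<Rightarrow> real) \<Rightarrow> (real \<times> real \<Rightarrow> real) \<Rightarrow> (real \<times> real \<Rightarrow> real) \<Rightarrow> bool" where
  "C1c \<theta> p q \<longleftrightarrow> C0c \<theta> \<and> C0c p \<and> C0c q \<and>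
    (\<forall>z \<in> closed_half_plane.
       (\<theta> has_derivative (\<lambda>h. fst h * p z + snd h * q z)) (at z within closed_half_plane))"

lemma C0c_bound:
  assumes "C0c f"
  obtains R where "0 \<le> R" "\<And>x t. 0 \<le> t \<Longrightarrow> R < \<bar>x\<bar> \<or> R < t \<Longrightarrow> f (x, t) = 0"
proof -
  obtain R where R: "0 < R" "\<And>z. z \<in> {z \<in> closed_half_plane. f z \<noteq> 0} \<Longrightarrow> norm z \<le> R"
    using assms unfolding C0c_def bounded_pos by auto
  have *: "f (x, t) = 0" if "0 \<le> t" "R < \<bar>x\<bar> \<or> R < t" for x t
  proof (rule ccontr)
    assume "f (x, t) \<noteq> 0"
    then have "norm (x, t) \<le> R" using R(2)[of "(x, t)"] that by auto
    moreover have "\<bar>x\<bar> \<le> norm (x, t)" "\<bar>t\<bar> \<le> norm (x, t)"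
      using norm_fst_le[of x t] norm_snd_le[of t x] by auto
    ultimately show False using that by auto
  qed
  show thesis by (rule that[of R]) (use R * in auto)
qed

lemma C0c_add: "C0c (\<lambda>z. f z + g z)" if "C0c f" "C0c g"
  using that unfolding C0c_def
  by (auto intro: continuous_on_add
      bounded_subset[of "{z \<in> closed_half_plane. f z \<noteq> 0} \<union> {z \<in> closed_half_plane. g z \<noteq> 0}"])

lemma C0c_cmult: "C0c (\<lambda>z. a * f z)" if "C0c f"
  using that unfolding C0c_def
  by (auto intro: continuous_on_mult_left bounded_subset[of "{z \<in> closed_half_plane. f z \<noteq> 0}"])

lemma C0c_integrable:
  assumes f: "C0c f" and [measurable]: "w \<in> borel_measurable borel" and w: "\<And>z. \<bar>w z\<bar> \<le> B"
  shows "set_integrable lborel half_plane (\<lambda>z. w z * f z)"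
proof -
  obtain R where R: "0 \<le> R" "\<And>x t. 0 \<le> t \<Longrightarrow> R < \<bar>x\<bar> \<or> R < t \<Longrightarrow> f (x, t) = 0"
    using C0c_bound[OF f] by blast
  define Q where "Q = {-R..R} \<times> {0..R}"
  have "compact Q" "continuous_on Q f"
    unfolding Q_def using f
    by (auto intro!: compact_Times intro: continuous_on_subset
        simp: C0c_def closed_half_plane_def)
  then have Q: "integrable lborel (\<lambda>z. indicator Q z *\<^sub>R f z)"
    by (rule borel_integrable_compact)
  have eq: "indicator half_plane z *\<^sub>R (w z * f z)
      = (indicator half_plane z * w z) * (indicator Q z *\<^sub>R f z)" for z
  proof (cases z)
    case (Pair x t)
    then show ?thesis using R(2)[of t x] by (cases "\<bar>x\<bar> \<le> R \<and> t \<le> R") (auto simp: Q_def indicator_def)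
  qed
  have "integrable lborel (\<lambda>z. (indicator half_plane z * w z) * (indicator Q z *\<^sub>R f z))"
  proof (rule Bochner_Integration.integrable_bound[OF integrable_mult_right[OF Q, of B]])
    have [measurable]: "(\<lambda>z. indicator Q z *\<^sub>R f z) \<in> borel_measurable lborel" 
      using Q by auto
    show "(\<lambda>z. (indicator half_plane z * w z) * (indicator Q z *\<^sub>R f z)) \<in> borel_measurable lborel"
      by measurable
    have "\<bar>indicator half_plane z * w z\<bar> \<le> \<bar>B\<bar>" for z
      using w[of z] by (auto simp: indicator_def)
    then show "AE z in lborel. norm ((indicator half_plane z * w z) * (indicator Q z *\<^sub>R f z))
        \<le> norm (B * (indicator Q z *\<^sub>R f z))"
      by (intro AE_I2) (simp only: real_norm_def abs_mult[of B] abs_mult[of "_ * w _"] mult_right_mono abs_ge_zero)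
  qed
  then show ?thesis unfolding set_integrable_def eq .
qed


section \<open>The shear to characteristic coordinates\<close>

definition shear :: "real \<Rightarrow> real \<times> real \<Rightarrow> real \<times> real" where
  "shear c z = (fst z + c * snd z, snd z)"

lemma measurable_shear [measurable]: "shear c \<in> borel \<rightarrow>\<^sub>M borel"
  unfolding shear_def[abs_def]
  by (intro borel_measurable_continuous_onI continuous_intros)

lemma shear_in_half_plane [simp]: "shear c z \<in> half_plane \<longleftrightarrow> z \<in> half_plane"
  by (cases z) (simp add: shear_def)

lemma shear_in_closed_half_plane [simp]: "shear c z \<in> closed_half_plane \<longleftrightarrow> z \<in> closed_half_plane"
  by (cases z) (simp add: shear_def)

text \<open>Each horizontal line is only translated, so Tonelli's theorem reduces this to translation
  invariance in one variable.\<close>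
lemma distr_shear: "distr lborel borel (shear c) = lborel"
proof (rule measure_eqI)
  fix A assume "A \<in> sets (distr lborel borel (shear c))"
  then have [measurable]: "A \<in> sets (borel :: (real \<times> real) measure)" by simp
  have A: "A \<in> sets (lborel \<Otimes>\<^sub>M lborel)" unfolding lborel_prod by simp
  have m: "(\<lambda>z. indicator A (shear c z)) \<in> borel_measurable (lborel \<Otimes>\<^sub>M lborel)"
    unfolding lborel_prod by simp
  have "emeasure (distr lborel borel (shear c)) A = (\<integral>\<^sup>+z. indicator A (shear c z) \<partial>lborel)"
    by (simp add: nn_integral_distr flip: nn_integral_indicator)
  also have "\<dots> = (\<integral>\<^sup>+t. (\<integral>\<^sup>+y. indicator A (y + c * t, t) \<partial>lborel) \<partial>lborel)"
    using lborel_pair.nn_integral_snd[OF m] by (simp add: lborel_prod shear_def)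
  also have "\<dots> = (\<integral>\<^sup>+t. (\<integral>\<^sup>+x. indicator A (x, t) \<partial>lborel) \<partial>lborel)"
  proof (rule nn_integral_cong)
    fix t :: real
    show "(\<integral>\<^sup>+y. indicator A (y + c * t, t) \<partial>lborel) = (\<integral>\<^sup>+x. indicator A (x, t) \<partial>lborel)"
      using nn_integral_real_affine[of "\<lambda>x. indicator A (x, t)" 1 "c * t"] by (simp add: add.commute)
  qed
  also have "\<dots> = (\<integral>\<^sup>+z. indicator A z \<partial>lborel)"
    using lborel_pair.nn_integral_snd[of "indicator A"] A by (simp add: lborel_prod)
  finally show "emeasure (distr lborel borel (shear c)) A = emeasure lborel A"
    by simp
qed simp

lemma set_integral_shear:
  fixes g :: "real \<times> real \<Rightarrow> real"
  assumes "set_integrable lborel half_plane g"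
  shows "(LINT z:half_plane|lborel. g (shear c z)) = (LINT z:half_plane|lborel. g z)"
proof -
  let ?g = "\<lambda>z. indicator half_plane z *\<^sub>R g z"
  have "?g \<in> borel_measurable borel" using assms by (auto simp: set_integrable_def)
  then have "integral\<^sup>L (distr lborel borel (shear c)) ?g = (LINT z|lborel. ?g (shear c z))"
    by (intro integral_distr) auto
  then show ?thesis
    by (simp add: distr_shear set_lebesgue_integral_def indicator_def)
qed

lemma C0c_shear:
  assumes "C0c f"
  shows "C0c (\<lambda>z. f (shear c z))"
proof -
  have "continuous_on closed_half_plane (\<lambda>z. f (shear c z))"
  proof (rule continuous_on_compose2[where s = closed_half_plane and f = "shear c"])
    show "continuous_on closed_half_plane f" using assms by (simp add: C0c_def)
    show "continuous_on closed_half_plane (shear c)"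
      unfolding shear_def[abs_def] by (intro continuous_intros)
  qed auto
  moreover have "bounded_linear (shear (-c))"
    unfolding shear_def[abs_def]
    by (intro bounded_linear_Pair bounded_linear_add bounded_linear_const_mult
        bounded_linear_fst bounded_linear_snd)
  then have "bounded (shear (-c) ` {z \<in> closed_half_plane. f z \<noteq> 0})"
    using assms by (intro bounded_linear_image) (auto simp: C0c_def)
  then have "bounded {z \<in> closed_half_plane. f (shear c z) \<noteq> 0}"
  proof (rule bounded_subset, clarify)
    fix x t assume "(x, t) \<in> closed_half_plane" "f (shear c (x, t)) \<noteq> 0"
    then show "(x, t) \<in> shear (-c) ` {z \<in> closed_half_plane. f z \<noteq> 0}"
      by (intro image_eqI[of _ _ "shear c (x, t)"]) (auto simp: shear_def)
  qed
  ultimately show ?thesis by (simp add: C0c_def)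
qed

text \<open>
  In characteristic coordinates the time derivative is the derivative \<open>\<theta>\<^sub>t + c \<theta>\<^sub>x\<close> along the
  characteristics. This is what reduces every statement about the moving shock to \<open>c = 0\<close>.
\<close>
lemma C1c_shear:
  assumes "C1c \<theta> p q"
  shows "C1c (\<lambda>z. \<theta> (shear c z)) (\<lambda>z. p (shear c z)) (\<lambda>z. q (shear c z) + c * p (shear c z))"
  unfolding C1c_def
proof (intro conjI ballI)
  show "C0c (\<lambda>z. \<theta> (shear c z))" "C0c (\<lambda>z. p (shear c z))"
    "C0c (\<lambda>z. q (shear c z) + c * p (shear c z))"
    using assms unfolding C1c_def
    by (auto intro!: C0c_shear[where c = c] C0c_add C0c_cmult)
  fix z :: "real \<times> real" assume z: "z \<in> closed_half_plane"
  have 1: "(shear c has_derivative shear c) (at z within closed_half_plane)"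
    unfolding shear_def[abs_def] by (auto intro!: derivative_eq_intros)
  have "(\<theta> has_derivative (\<lambda>h. fst h * p (shear c z) + snd h * q (shear c z)))
      (at (shear c z) within closed_half_plane)"
    using assms z unfolding C1c_def by (metis shear_in_closed_half_plane)
  then have 2: "(\<theta> has_derivative (\<lambda>h. fst h * p (shear c z) + snd h * q (shear c z)))
      (at (shear c z) within shear c ` closed_half_plane)"
    by (rule has_derivative_subset) (simp add: image_subset_iff)
  show "((\<lambda>z. \<theta> (shear c z)) has_derivative (\<lambda>h. fst h * p (shear c z) +
       snd h * (q (shear c z) + c * p (shear c z)))) (at z within closed_half_plane)"
    using diff_chain_within[OF 1 2, unfolded o_def]
    by (rule has_derivative_eq_rhs) (simp add: shear_def algebra_simps fun_eq_iff)
qed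


section \<open>Integration along horizontal and vertical lines\<close>

text \<open>
  The fundamental theorem of calculus for the unbounded domains that occur below (a half line
  or the whole line), when the integrand vanishes outside an interval. Whether \<open>a\<close> belongs to
  \<open>A\<close> is left open since a point is a null set; this matters for \<open>A = {0<..}\<close>.
\<close>
lemma set_integral_FTC:
  fixes F f :: "real \<Rightarrow> real"
  assumes "a \<le> b"
    and F: "\<And>x. a \<le> x \<Longrightarrow> x \<le> b \<Longrightarrow> (F has_real_derivative f x) (at x within {a..b})"
    and f: "continuous_on {a..b} f"
    and [measurable]: "A \<in> sets borel" and A: "{a<..b} \<subseteq> A"
    and 0: "\<And>x. x \<in> A \<Longrightarrow> x \<notin> {a..b} \<Longrightarrow> f x = 0"
  shows "set_integrable lborel A f" "(LINT x:A|lborel. f x) = F b - F a"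
proof -
  have I: "has_bochner_integral lborel (\<lambda>x. indicator {a..b} x *\<^sub>R f x) (F b - F a)"
    using assms by (intro has_bochner_integral_FTC_Icc)
      (auto simp: has_real_derivative_iff_has_vector_derivative)
  then have m0 [measurable]: "(\<lambda>x. indicator {a..b} x *\<^sub>R f x) \<in> borel_measurable lborel"
    by (auto simp: has_bochner_integral_iff)
  have "(\<lambda>x. indicator A x *\<^sub>R f x) = (\<lambda>x. indicator A x * (indicator {a..b} x *\<^sub>R f x))"
    using 0 by (auto simp: indicator_def fun_eq_iff)
  moreover have "(\<lambda>x. indicator A x * (indicator {a..b} x *\<^sub>R f x)) \<in> borel_measurable lborel"
    by measurable
  ultimately have m: "(\<lambda>x. indicator A x *\<^sub>R f x) \<in> borel_measurable lborel" by simp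
  have "AE x in lborel. x \<noteq> a" by (rule AE_lborel_singleton)
  then have "AE x in lborel. indicator {a..b} x *\<^sub>R f x = indicator A x *\<^sub>R f x"
  proof eventually_elim
    case (elim x)
    then have "x \<in> A" if "x \<in> {a..b}"
      using that by (intro subsetD[OF A]) auto
    then show ?case using 0[of x] by (auto simp: indicator_def)
  qed
  then have "has_bochner_integral lborel (\<lambda>x. indicator A x *\<^sub>R f x) (F b - F a)"
    using has_bochner_integral_cong_AE[OF m0 m] I by blast
  then show "set_integrable lborel A f" "(LINT x:A|lborel. f x) = F b - F a"
    unfolding set_integrable_def set_lebesgue_integral_def
    by (auto simp: has_bochner_integral_iff)
qed

lemma C1c_slices:
  assumes "C1c \<theta> p q" "0 \<le> t"
  shows "((\<lambda>x. \<theta> (x, t)) has_real_derivative p (x, t)) (at x)"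
    and "((\<lambda>s. \<theta> (x, s)) has_real_derivative q (x, t)) (at t within {0..})"
proof -
  have D: "(\<theta> has_derivative (\<lambda>h. fst h * p (x, t) + snd h * q (x, t)))
      (at (x, t) within closed_half_plane)"
    using assms by (auto simp: C1c_def)
  have 1: "((\<lambda>x. (x, t)) has_derivative (\<lambda>h. (h, 0))) (at x within UNIV)"
    by (auto intro!: derivative_eq_intros)
  have 2: "(\<theta> has_derivative (\<lambda>h. fst h * p (x, t) + snd h * q (x, t)))
      (at (x, t) within (\<lambda>x. (x, t)) ` UNIV)"
    by (rule has_derivative_subset[OF D]) (use assms in auto)
  show "((\<lambda>x. \<theta> (x, t)) has_real_derivative p (x, t)) (at x)"
    using diff_chain_within[OF 1 2]
    by (simp add: o_def has_field_derivative_def mult_commute_abs)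
  have 3: "((\<lambda>s. (x, s)) has_derivative (\<lambda>h. (0, h))) (at t within {0..})"
    by (auto intro!: derivative_eq_intros)
  have 4: "(\<theta> has_derivative (\<lambda>h. fst h * p (x, t) + snd h * q (x, t)))
      (at (x, t) within (\<lambda>s. (x, s)) ` {0..})"
    by (rule has_derivative_subset[OF D]) auto
  show "((\<lambda>s. \<theta> (x, s)) has_real_derivative q (x, t)) (at t within {0..})"
    using diff_chain_within[OF 3 4]
    by (simp add: o_def has_field_derivative_def mult_commute_abs)
qed

lemma C0c_continuous_slices:
  assumes "C0c f"
  shows "continuous_on {0..} (\<lambda>t. f (x, t))" "0 \<le> t \<Longrightarrow> continuous_on UNIV (\<lambda>x. f (x, t))"
  using assms unfolding C0c_def
  by (auto intro!: continuous_on_compose2[of closed_half_plane f] continuous_intros)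

lemma integral_t_slice:
  assumes "C1c \<theta> p q"
  shows "(LINT t:{0<..}|lborel. q (x, t)) = - \<theta> (x, 0)"
proof -
  obtain R where R: "0 \<le> R" "\<And>x t. 0 \<le> t \<Longrightarrow> R < \<bar>x\<bar> \<or> R < t \<Longrightarrow> q (x, t) = 0"
    using assms C0c_bound[of q] unfolding C1c_def by blast
  obtain R' where R': "0 \<le> R'" "\<And>x t. 0 \<le> t \<Longrightarrow> R' < \<bar>x\<bar> \<or> R' < t \<Longrightarrow> \<theta> (x, t) = 0"
    using assms C0c_bound[of \<theta>] unfolding C1c_def by blast
  \<comment> \<open>The common bound is increased by 1 so that \<open>\<theta>\<close> vanishes at the endpoint itself.\<close>
  define b where "b = R + R' + 1"
  have "(LINT t:{0<..}|lborel. q (x, t)) = \<theta> (x, b) - \<theta> (x, 0)"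
  proof (rule set_integral_FTC(2)[where F = "\<lambda>t. \<theta> (x, t)"])
    show "((\<lambda>t. \<theta> (x, t)) has_real_derivative q (x, t)) (at t within {0..b})" if "0 \<le> t" "t \<le> b" for t
      using DERIV_subset[OF C1c_slices(2)[OF assms that(1)]] by auto
    show "continuous_on {0..b} (\<lambda>t. q (x, t))"
      using C0c_continuous_slices(1)[of q x] assms
      by (auto simp: C1c_def elim: continuous_on_subset)
  qed (use R R' in \<open>auto simp: b_def\<close>)
  then show ?thesis using R R' by (simp add: b_def)
qed

lemma integral_x_slice:
  assumes "C1c \<theta> p q" "0 \<le> t"
  shows "set_integrable lborel {..0} (\<lambda>x. p (x, t))" "(LINT x:{..0}|lborel. p (x, t)) = \<theta> (0, t)"
    and "integrable lborel (\<lambda>x. p (x, t))" "(LINT x|lborel. p (x, t)) = 0"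
proof -
  obtain R where R: "0 \<le> R" "\<And>x t. 0 \<le> t \<Longrightarrow> R < \<bar>x\<bar> \<or> R < t \<Longrightarrow> p (x, t) = 0"
    using assms C0c_bound[of p] unfolding C1c_def by blast
  obtain R' where R': "0 \<le> R'" "\<And>x t. 0 \<le> t \<Longrightarrow> R' < \<bar>x\<bar> \<or> R' < t \<Longrightarrow> \<theta> (x, t) = 0"
    using assms C0c_bound[of \<theta>] unfolding C1c_def by blast
  define b where "b = R + R' + 1"
  have D: "((\<lambda>x. \<theta> (x, t)) has_real_derivative p (x, t)) (at x within S)" for x S
    using DERIV_subset[OF C1c_slices(1)[OF assms]] by auto
  have C: "continuous_on S (\<lambda>x. p (x, t))" for S
    using C0c_continuous_slices(2)[of p t] assms
    by (auto simp: C1c_def elim: continuous_on_subset)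
  have z: "\<theta> (- b, t) = 0" "\<theta> (b, t) = 0" using R R' assms by (auto simp: b_def)
  have b: "0 \<le> b" "\<And>x. x \<notin> {-b..b} \<Longrightarrow> p (x, t) = 0" using R R' assms by (force simp: b_def)+
  show "set_integrable lborel {..0} (\<lambda>x. p (x, t))"
    by (rule set_integral_FTC(1)[OF _ D C, of "-b" 0]) (use b in auto)
  have "(LINT x:{..0}|lborel. p (x, t)) = \<theta> (0, t) - \<theta> (-b, t)"
    by (rule set_integral_FTC(2)[OF _ D C, of "-b" 0]) (use b in auto)
  then show "(LINT x:{..0}|lborel. p (x, t)) = \<theta> (0, t)" by (simp add: z)
  have "set_integrable lborel UNIV (\<lambda>x. p (x, t))"
    by (rule set_integral_FTC(1)[OF _ D C, of "-b" b]) (use b in auto)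
  then show "integrable lborel (\<lambda>x. p (x, t))" by (simp add: set_integrable_def)
  have "(LINT x:UNIV|lborel. p (x, t)) = \<theta> (b, t) - \<theta> (-b, t)"
    by (rule set_integral_FTC(2)[OF _ D C, of "-b" b]) (use b in auto)
  then show "(LINT x|lborel. p (x, t)) = 0" by (simp add: z set_lebesgue_integral_def)
qed

text \<open>
  Multiplying by the time variable stays within the class; the integral of the time derivative
  of \<open>t \<theta>\<close> vanishes because \<open>t \<theta>\<close> is zero initially. This is the integration by parts needed for
  an amplitude that grows linearly in time.
\<close>
lemma C1c_mult_time:
  assumes "C1c \<theta> p q"
  shows "C1c (\<lambda>z. snd z * \<theta> z) (\<lambda>z. snd z * p z) (\<lambda>z. \<theta> z + snd z * q z)"
proof -
  have C0c: "C0c (\<lambda>z. snd z * f z)" if "C0c f" for f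
    using that unfolding C0c_def
    by (auto intro!: continuous_on_mult continuous_on_snd continuous_on_id
        intro: bounded_subset[of "{z \<in> closed_half_plane. f z \<noteq> 0}"])
  show ?thesis
    unfolding C1c_def
  proof (intro conjI ballI)
    show "C0c (\<lambda>z. snd z * \<theta> z)" "C0c (\<lambda>z. snd z * p z)" "C0c (\<lambda>z. \<theta> z + snd z * q z)"
      using assms by (auto simp: C1c_def intro!: C0c C0c_add[OF _ C0c])
    fix z :: "real \<times> real" assume "z \<in> closed_half_plane"
    then have "(\<theta> has_derivative (\<lambda>h. fst h * p z + snd h * q z)) (at z within closed_half_plane)"
      using assms by (simp add: C1c_def)
    from has_derivative_mult[OF has_derivative_snd[OF has_derivative_ident] this]
    show "((\<lambda>z. snd z * \<theta> z) has_derivative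
        (\<lambda>h. fst h * (snd z * p z) + snd h * (\<theta> z + snd z * q z))) (at z within closed_half_plane)"
      by (simp add: algebra_simps)
  qed
qed

lemma C0c_ray_integrable:
  assumes "C0c f"
  shows "set_integrable lborel {0<..} (\<lambda>t. f (c * t, t))"
proof -
  have g: "C0c (\<lambda>z. f (shear c z))" by (rule C0c_shear[OF assms])
  then obtain R where R: "\<And>x t. 0 \<le> t \<Longrightarrow> R < \<bar>x\<bar> \<or> R < t \<Longrightarrow> f (shear c (x, t)) = 0"
    using C0c_bound by blast
  have "continuous_on {0..R} (\<lambda>t. f (shear c (0, t)))"
    using C0c_continuous_slices(1)[OF g, of 0] by (rule continuous_on_subset) auto
  then have "integrable lborel (\<lambda>t. indicator {0..R} t *\<^sub>R f (shear c (0, t)))"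
    by (intro borel_integrable_compact) auto
  then have "integrable lborel
      (\<lambda>t. indicator {0<..} t *\<^sub>R (indicator {0..R} t *\<^sub>R f (shear c (0, t))))"
    by (rule integrable_mult_indicator[rotated]) simp
  also have "(\<lambda>t. indicator {0<..} t *\<^sub>R (indicator {0..R} t *\<^sub>R f (shear c (0, t)))) =
      (\<lambda>t. indicator {0<..} t *\<^sub>R f (c * t, t))"
    using R[of _ 0] by (auto simp: fun_eq_iff indicator_def shear_def)
  finally show ?thesis by (simp add: set_integrable_def)
qed

lemma integral_time_weighted:
  assumes "C1c \<theta> p q"
  shows "set_integrable lborel {0<..} (\<lambda>t. t * (q (c * t, t) + c * p (c * t, t)))"
    and "(LINT t:{0<..}|lborel. t * (q (c * t, t) + c * p (c * t, t))) =
      - (LINT t:{0<..}|lborel. \<theta> (c * t, t))"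
proof -
  let ?F = "\<lambda>t. \<theta> (c * t, t) + t * (q (c * t, t) + c * p (c * t, t))"
  have S: "C1c (\<lambda>z. \<theta> (shear c z)) (\<lambda>z. p (shear c z)) (\<lambda>z. q (shear c z) + c * p (shear c z))"
    by (rule C1c_shear[OF assms])
  note S' = C1c_mult_time[OF S]
  have 1: "set_integrable lborel {0<..} ?F"
    using C0c_ray_integrable[of _ 0] S'[unfolded C1c_def]
    by (force simp: shear_def)
  have 2: "set_integrable lborel {0<..} (\<lambda>t. \<theta> (c * t, t))"
    using assms by (auto simp: C1c_def intro: C0c_ray_integrable)
  have 3: "(LINT t:{0<..}|lborel. ?F t) = 0"
    using integral_t_slice[OF S', of 0] by (simp add: shear_def)
  show "set_integrable lborel {0<..} (\<lambda>t. t * (q (c * t, t) + c * p (c * t, t)))"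
    using set_integral_diff(1)[OF 1 2] by simp
  show "(LINT t:{0<..}|lborel. t * (q (c * t, t) + c * p (c * t, t))) =
      - (LINT t:{0<..}|lborel. \<theta> (c * t, t))"
    using set_integral_diff(2)[OF 1 2] 3 by simp
qed


section \<open>Integrals against a travelling step\<close>

text \<open>
  The weak form of \<open>v\<^sub>t = 0\<close> for a stationary profile \<open>h\<close>, that is, of the transport equation
  in characteristic coordinates: integrate first in time.
\<close>
lemma integral_vertical:
  assumes \<theta>: "C1c \<theta> p q" and [measurable]: "h \<in> borel_measurable borel" and h: "\<And>x. \<bar>h x\<bar> \<le> B"
  shows "integrable lborel (\<lambda>x. h x * \<theta> (x, 0))"
    and "(LINT z:half_plane|lborel. h (fst z) * q z) = - (LINT x|lborel. h x * \<theta> (x, 0))"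
proof -
  have [measurable]: "fst \<in> borel_measurable (borel :: (real \<times> real) measure)"
    by (intro borel_measurable_continuous_onI continuous_intros)
  let ?f = "\<lambda>z. indicator half_plane z *\<^sub>R (h (fst z) * q z)"
  have "set_integrable lborel half_plane (\<lambda>z. h (fst z) * q z)"
    using \<theta> h by (intro C0c_integrable[where B = B]) (auto simp: C1c_def)
  then have I: "integrable (lborel \<Otimes>\<^sub>M lborel) ?f"
    by (simp add: set_integrable_def lborel_prod)
  have inner: "(LINT t|lborel. ?f (x, t)) = - (h x * \<theta> (x, 0))" for x
  proof -
    have "(LINT t|lborel. ?f (x, t)) = (LINT t:{0<..}|lborel. h x * q (x, t))"
      unfolding set_lebesgue_integral_def
      by (intro Bochner_Integration.integral_cong) (auto simp: indicator_def)
    then show ?thesis using integral_t_slice[OF \<theta>, of x] by simp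
  qed
  show "integrable lborel (\<lambda>x. h x * \<theta> (x, 0))"
    using lborel_pair.integrable_fst'[OF I] unfolding inner by simp
  show "(LINT z:half_plane|lborel. h (fst z) * q z) = - (LINT x|lborel. h x * \<theta> (x, 0))"
    using lborel_pair.integral_fst'[OF I] unfolding inner by (simp add: lborel_prod set_lebesgue_integral_def)
qed

lemma measurable_heaviside [measurable]: "heaviside \<in> borel_measurable borel"
  unfolding heaviside_def[abs_def] by measurable

definition step :: "real \<Rightarrow> real \<Rightarrow> real \<Rightarrow> real \<times> real \<Rightarrow> real" where
  "step a b c z = a + b * heaviside (- fst z + c * snd z)"

lemma measurable_step [measurable]: "step a b c \<in> borel_measurable borel"
proof -
  have [measurable]: "(\<lambda>z. - fst z + c * snd z :: real) \<in> borel_measurable borel"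
    by (intro borel_measurable_continuous_onI continuous_intros)
  show ?thesis unfolding step_def[abs_def] by measurable
qed

lemma abs_step_le: "\<bar>step a b c z\<bar> \<le> \<bar>a\<bar> + \<bar>b\<bar>"
  by (auto simp: step_def heaviside_def)

lemma step_integrable:
  "C0c f \<Longrightarrow> set_integrable lborel half_plane (\<lambda>z. step a b c z * f z)"
  by (rule C0c_integrable[OF _ measurable_step abs_step_le])

lemma step_shear: "step a b c (shear c z) = a + b * heaviside (- fst z)"
  by (simp add: step_def shear_def)

text \<open>
  Here the integration is first in space. The constant \<open>a\<close> contributes nothing, because a
  compactly supported derivative has integral zero over the whole line.
\<close>
lemma integral_horizontal:
  assumes \<theta>: "C1c \<theta> p q"
  shows "(LINT z:half_plane|lborel. step a b 0 z * p z) = b * (LINT t:{0<..}|lborel. \<theta> (0, t))"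
proof -
  let ?f = "\<lambda>z. indicator half_plane z *\<^sub>R (step a b 0 z * p z)"
  have I: "integrable (lborel \<Otimes>\<^sub>M lborel) ?f"
    using step_integrable[of p] \<theta> by (simp add: set_integrable_def lborel_prod C1c_def)
  have inner: "(LINT x|lborel. ?f (x, t)) = indicator {0<..} t *\<^sub>R (b * \<theta> (0, t))" for t
  proof (cases "0 < t")
    case True
    then have t: "0 \<le> t" by simp
    note P = integral_x_slice[OF \<theta> t]
    have "(LINT x|lborel. ?f (x, t)) =
        (LINT x|lborel. a * p (x, t) + b * (indicator {..0} x *\<^sub>R p (x, t)))"
      using True by (intro Bochner_Integration.integral_cong)
        (auto simp: indicator_def step_def heaviside_def algebra_simps)
    also have "\<dots> = a * (LINT x|lborel. p (x, t)) + b * (LINT x:{..0}|lborel. p (x, t))"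
      using P(1,3) by (simp add: set_integrable_def set_lebesgue_integral_def)
    finally show ?thesis using True P(2,4) by simp
  qed simp
  have "(LINT z:half_plane|lborel. step a b 0 z * p z) = (LINT t|lborel. LINT x|lborel. ?f (x, t))"
    using lborel_pair.integral_snd[of "\<lambda>x t. ?f (x, t)"] I
    by (simp add: lborel_prod set_lebesgue_integral_def case_prod_unfold)
  also have "\<dots> = (LINT t:{0<..}|lborel. b * \<theta> (0, t))"
    unfolding inner set_lebesgue_integral_def ..
  finally show ?thesis by simp
qed

text \<open>The weak form of \<open>v\<^sub>x = - b \<delta>(x - c t)\<close> for the step \<open>v\<close>.\<close>
lemma integral_step_x:
  assumes "C1c \<theta> p q"
  shows "(LINT z:half_plane|lborel. step a b c z * p z) = b * (LINT t:{0<..}|lborel. \<theta> (c * t, t))"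
proof -
  have "(LINT z:half_plane|lborel. step a b c z * p z) =
      (LINT z:half_plane|lborel. step a b c (shear c z) * p (shear c z))"
    using assms by (intro set_integral_shear[symmetric] step_integrable) (simp add: C1c_def)
  also have "\<dots> = (LINT z:half_plane|lborel. step a b 0 z * p (shear c z))"
    unfolding step_shear by (simp add: step_def)
  also have "\<dots> = b * (LINT t:{0<..}|lborel. \<theta> (c * t, t))"
    using integral_horizontal[OF C1c_shear[OF assms, of c]] by (simp add: shear_def)
  finally show ?thesis .
qed

text \<open>The weak form of \<open>v\<^sub>t + c v\<^sub>x = 0\<close> for the step \<open>v\<close>, initial datum included.\<close>
lemma integral_step_transport:
  assumes "C1c \<theta> p q"
  shows "integrable lborel (\<lambda>x. (a + b * heaviside (- x)) * \<theta> (x, 0))"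
    and "(LINT z:half_plane|lborel. step a b c z * (q z + c * p z)) =
      - (LINT x|lborel. (a + b * heaviside (- x)) * \<theta> (x, 0))"
proof -
  have m: "(\<lambda>x. a + b * heaviside (- x)) \<in> borel_measurable borel" by measurable
  have h: "\<bar>a + b * heaviside (- x)\<bar> \<le> \<bar>a\<bar> + \<bar>b\<bar>" for x
    using abs_step_le[of a b 0 "(x, 0)"] by (simp add: step_def)
  note V = integral_vertical[OF C1c_shear[OF assms, of c] m h]
  show "integrable lborel (\<lambda>x. (a + b * heaviside (- x)) * \<theta> (x, 0))"
    using V(1) by (simp add: shear_def)
  have "(LINT z:half_plane|lborel. step a b c z * (q z + c * p z)) =
      (LINT z:half_plane|lborel. step a b c (shear c z) * (q (shear c z) + c * p (shear c z)))"
    using assms by (intro set_integral_shear[symmetric] step_integrable C0c_add C0c_cmult)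
      (simp_all add: C1c_def)
  then show "(LINT z:half_plane|lborel. step a b c z * (q z + c * p z)) =
      - (LINT x|lborel. (a + b * heaviside (- x)) * \<theta> (x, 0))"
    using V(2) unfolding step_shear by (simp add: shear_def)
qed


section \<open>Measures carried by the shock line\<close>

text \<open>
  The positive part of the real weight \<open>a\<close> times the image of \<open>dt\<close> on the line \<open>x = c t\<close>. Taking
  the positive part makes the pair in \<open>signed_ray\<close> below the Jordan decomposition for either sign
  of \<open>a\<close>. Negative times are included, but integrals are restricted to the half plane anyway.
\<close>
definition ray_measure :: "real \<Rightarrow> real \<Rightarrow> (real \<times> real) measure" where
  "ray_measure c a = distr (density lborel (\<lambda>_. ennreal (max 0 a))) borel (\<lambda>t. (c * t, t))"

definition signed_ray :: "real \<Rightarrow> real \<Rightarrow> signed_measure" where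
  "signed_ray c a = (ray_measure c a, ray_measure c (- a))"

lemma measurable_ray [measurable]: "(\<lambda>t. (c * t, t)) \<in> borel \<rightarrow>\<^sub>M borel" for c :: real
  by (intro borel_measurable_continuous_onI continuous_intros)

lemma signed_radon_ray: "signed_radon (signed_ray c a)"
proof -
  have "locally_finite (ray_measure c b)" for b
    unfolding locally_finite_def
  proof (intro conjI allI impI)
    fix K :: "(real \<times> real) set" assume K: "compact K"
    then have [measurable]: "K \<in> sets borel" by (simp add: borel_compact)
    let ?A = "(\<lambda>t. (c * t, t)) -` (half_plane \<inter> K)"
    have A: "?A \<in> sets borel"
      using measurable_sets[OF measurable_ray, of "half_plane \<inter> K" c] by simp
    have "bounded ?A"
      using compact_imp_bounded[OF compact_continuous_image[OF continuous_on_snd[OF continuous_on_id] K]]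
      by (rule bounded_subset) force
    then have "emeasure lborel ?A < \<infinity>" by (rule emeasure_bounded_finite)
    then show "emeasure (ray_measure c b) (half_plane \<inter> K) < \<infinity>"
      using A by (simp add: ray_measure_def emeasure_distr emeasure_density
          nn_integral_cmult_indicator ennreal_mult_less_top)
  qed (simp add: ray_measure_def)
  then show ?thesis by (simp add: signed_radon_def signed_ray_def)
qed

text \<open>
  The factor \<open>w\<close> need only be constant on the line. This is the situation of the averaged
  velocity, which is discontinuous across the line but has a well-defined value on it.
\<close>
lemma ray_integral:
  assumes f: "C0c f" and [measurable]: "w \<in> borel_measurable borel" and w: "\<And>t. w (c * t, t) = k"
  shows "set_integrable (ray_measure c a) half_plane (\<lambda>z. w z * f z)"
    and "(LINT z:half_plane|ray_measure c a. w z * f z) =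
      max 0 a * (k * (LINT t:{0<..}|lborel. f (c * t, t)))"
proof -
  let ?g = "\<lambda>z. indicator half_plane z *\<^sub>R (w z * f z)"
  have "(\<lambda>z. indicator half_plane z *\<^sub>R f z) \<in> borel_measurable borel"
    using f half_plane_subset
    by (intro borel_measurable_continuous_on_indicator) (auto simp: C0c_def intro: continuous_on_subset)
  then have "(\<lambda>z. w z * (indicator half_plane z *\<^sub>R f z)) \<in> borel_measurable borel"
    by measurable
  also have "(\<lambda>z. w z * (indicator half_plane z *\<^sub>R f z)) = ?g"
    by (auto simp: algebra_simps)
  finally have g [measurable]: "?g \<in> borel_measurable borel" .
  have eq: "?g (c * t, t) = indicator {0<..} t *\<^sub>R (k * f (c * t, t))" for t
    using w by (simp add: indicator_def)
  have m: "(\<lambda>t. ?g (c * t, t)) \<in> borel_measurable lborel"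
    using measurable_compose[OF measurable_ray g] by simp
  have I: "integrable lborel (\<lambda>t. ?g (c * t, t))"
    using set_integrable_mult_right[OF C0c_ray_integrable[OF f], of k] 
    unfolding eq set_integrable_def by simp
  have "integrable (density lborel (\<lambda>_. ennreal (max 0 a))) (\<lambda>t. ?g (c * t, t))"
    using I by (subst integrable_real_density[OF _ _ m]) auto
  then show "set_integrable (ray_measure c a) half_plane (\<lambda>z. w z * f z)"
    using g unfolding set_integrable_def ray_measure_def
    by (subst integrable_distr_eq) auto
  have "(LINT z|ray_measure c a. ?g z) = (LINT t|density lborel (\<lambda>_. ennreal (max 0 a)). ?g (c * t, t))"
    using g unfolding ray_measure_def by (intro integral_distr) auto
  also have "\<dots> = (LINT t|lborel. max 0 a * ?g (c * t, t))"
    by (rule integral_real_density[OF _ _ m]) auto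
  also have "\<dots> = max 0 a * (k * (LINT t:{0<..}|lborel. f (c * t, t)))"
    using set_integral_mult_right[of lborel "{0<..}" k "\<lambda>t. f (c * t, t)"]
    unfolding eq integral_mult_right_zero set_lebesgue_integral_def by simp
  finally show "(LINT z:half_plane|ray_measure c a. w z * f z) =
      max 0 a * (k * (LINT t:{0<..}|lborel. f (c * t, t)))"
    by (simp add: set_lebesgue_integral_def)
qed

lemma signed_ray_integral:
  assumes "C0c f" "w \<in> borel_measurable borel" "\<And>t. w (c * t, t) = k"
  shows "signed_integrable (signed_ray c a) (\<lambda>z. w z * f z)"
    and "signed_integral (signed_ray c a) (\<lambda>z. w z * f z) =
      a * (k * (LINT t:{0<..}|lborel. f (c * t, t)))"
proof -
  show "signed_integrable (signed_ray c a) (\<lambda>z. w z * f z)"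
    unfolding signed_integrable_def signed_ray_def fst_conv snd_conv
    by (intro conjI ray_integral(1)[OF assms])
  have "max 0 a * x - max 0 (- a) * x = a * x" for x :: real
    by (cases "0 \<le> a") simp_all
  then show "signed_integral (signed_ray c a) (\<lambda>z. w z * f z) =
      a * (k * (LINT t:{0<..}|lborel. f (c * t, t)))"
    unfolding signed_integral_def signed_ray_def fst_conv snd_conv ray_integral(2)[OF assms]
    by blast
qed


section \<open>Test functions\<close>

lemma has_derivative_unique_closed_half_plane:
  assumes "z \<in> closed_half_plane"
    and "(f has_derivative D) (at z within closed_half_plane)"
    and "(f has_derivative D') (at z within closed_half_plane)"
  shows "D = D'"
proof (rule frechet_derivative_unique_within[OF assms(2,3)])
  fix i :: "real \<times> real" and e :: real assume "i \<in> Basis" "0 < e"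
  then show "\<exists>d. 0 < \<bar>d\<bar> \<and> \<bar>d\<bar> < e \<and> z + d *\<^sub>R i \<in> closed_half_plane"
    using assms(1) by (intro exI[of _ "e / 2"]) (auto simp: closed_half_plane_def Basis_prod_def)
qed

lemma at_within_closed_half_plane:
  assumes "S \<in> {half_plane, closed_half_plane}" "z \<in> S"
  shows "at z within S = at z within closed_half_plane"
proof (cases "S = half_plane")
  case True
  then have "z \<in> interior S" using assms interior_open[OF open_half_plane] by simp
  then have "z \<in> interior closed_half_plane"
    using interior_mono[OF half_plane_subset] True by auto
  then show ?thesis using \<open>z \<in> interior S\<close> by (simp only: at_within_interior)
qed (use assms in simp)

text \<open>
  A test function on the open half plane vanishes near \<open>t = 0\<close>, so its extension by zero is
  again \<open>C\<^sup>1\<close> up to the boundary. The two classes of test functions are thereby reduced to one.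
  For a point of the closed half plane there are two cases: near a point of \<open>S\<close> the extension is
  \<open>\<psi>\<close> itself, and every other point has a neighbourhood that avoids the compact support.
\<close>
lemma test_function_C1c:
  assumes S: "S \<in> {half_plane, closed_half_plane}" and \<psi>: "\<psi> \<in> test_functions S"
  shows "C1c (\<lambda>z. if z \<in> S then \<psi> z else 0) (\<lambda>z. if z \<in> S then partial_x S \<psi> z else 0)
    (\<lambda>z. if z \<in> S then partial_t S \<psi> z else 0)"
proof -
  obtain K where K: "compact K" "K \<subseteq> S" "\<And>z. z \<in> S - K \<Longrightarrow> \<psi> z = 0"
    using \<psi> by (auto simp: test_functions_def)
  have "Ck_on 1 S \<psi>" using \<psi> by (simp add: test_functions_def smooth_on_def)
  then have C: "\<psi> differentiable_on S" "continuous_on S (partial_x S \<psi>)"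
    "continuous_on S (partial_t S \<psi>)"
    by auto
  have sub: "S \<subseteq> closed_half_plane" using S half_plane_subset by auto
  let ?e = "\<lambda>f z. if z \<in> S then f z else (0::real)"
  have off: "\<forall>\<^sub>F y in at z within closed_half_plane. y \<notin> K" if "z \<notin> K" for z
    using compact_imp_closed[OF K(1)] that
    by (auto simp: eventually_at_topological intro!: exI[of _ "- K"])
  have D0: "(?e \<psi> has_derivative (\<lambda>_. 0)) (at z within closed_half_plane)"
    if "z \<in> closed_half_plane" "z \<notin> K" for z
  proof -
    have "\<forall>\<^sub>F y in at z within closed_half_plane. 0 = ?e \<psi> y"
      using off[OF that(2)] by eventually_elim (use K(3) in auto)
    then show ?thesis
      using that K by (intro has_derivative_transform_eventually[OF has_derivative_const]) auto
  qed
  have D1: "(?e \<psi> has_derivative (\<lambda>h. fst h * partial_x S \<psi> z + snd h * partial_t S \<psi> z))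
      (at z within closed_half_plane)" if z: "z \<in> S" for z
  proof -
    have d: "(\<psi> has_derivative frechet_derivative \<psi> (at z within S)) (at z within S)"
      using C(1) z by (simp add: differentiable_on_def frechet_derivative_works)
    interpret linear "frechet_derivative \<psi> (at z within S)"
      by (rule has_derivative_linear[OF d])
    have "frechet_derivative \<psi> (at z within S) =
        (\<lambda>h. fst h * partial_x S \<psi> z + snd h * partial_t S \<psi> z)"
    proof
      fix h :: "real \<times> real"
      have "frechet_derivative \<psi> (at z within S) h = frechet_derivative \<psi> (at z within S)
          (fst h *\<^sub>R (1, 0) + snd h *\<^sub>R (0, 1))"
        by (rule arg_cong[where f = "frechet_derivative \<psi> (at z within S)"]) (cases h, simp)
      then show "frechet_derivative \<psi> (at z within S) h =
          fst h * partial_x S \<psi> z + snd h * partial_t S \<psi> z"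
        by (simp only: add scale partial_def real_scaleR_def)
    qed
    with d have "(\<psi> has_derivative (\<lambda>h. fst h * partial_x S \<psi> z + snd h * partial_t S \<psi> z))
        (at z within S)"
      by (rule has_derivative_eq_rhs)
    then have "(?e \<psi> has_derivative (\<lambda>h. fst h * partial_x S \<psi> z + snd h * partial_t S \<psi> z))
        (at z within S)"
      by (rule has_derivative_transform[OF z, rotated]) simp
    then show ?thesis using at_within_closed_half_plane[OF S z] by simp
  qed
  have zero: "partial_x S \<psi> z = 0" "partial_t S \<psi> z = 0" if z: "z \<in> S - K" for z
  proof -
    have "(\<lambda>h. fst h * partial_x S \<psi> z + snd h * partial_t S \<psi> z) = (\<lambda>_. 0)"
      using z sub by (intro has_derivative_unique_closed_half_plane[OF _ D1 D0]) auto
    from fun_cong[OF this, of "(1, 0)"] fun_cong[OF this, of "(0, 1)"]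
    show "partial_x S \<psi> z = 0" "partial_t S \<psi> z = 0" by simp_all
  qed
  have C0c: "C0c (?e f)" if f: "continuous_on S f" "\<And>z. z \<in> S - K \<Longrightarrow> f z = 0" for f
    unfolding C0c_def
  proof
    have "((?e f) \<longlongrightarrow> ?e f z) (at z within closed_half_plane)" if "z \<in> closed_half_plane" for z
    proof (cases "z \<in> S")
      case True
      then have "(f \<longlongrightarrow> f z) (at z within S)" using f(1) by (simp add: continuous_on_def)
      moreover have "\<forall>\<^sub>F y in at z within S. f y = ?e f y"
        by (auto simp: eventually_at_filter)
      ultimately have "(?e f \<longlongrightarrow> f z) (at z within S)"
        using tendsto_cong by fast
      then show ?thesis using True at_within_closed_half_plane[OF S True] by simp
    next
      case False
      then have "z \<notin> K" using K(2) by auto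
      from off[OF this] have "\<forall>\<^sub>F y in at z within closed_half_plane. ?e f y = 0"
        by (rule eventually_mono) (use f(2) in auto)
      then show ?thesis using False by (simp add: tendsto_eventually)
    qed
    then show "continuous_on closed_half_plane (?e f)" by (simp add: continuous_on_def)
    show "bounded {z \<in> closed_half_plane. ?e f z \<noteq> 0}"
      using compact_imp_bounded[OF K(1)] by (rule bounded_subset) (use f(2) in auto)
  qed
  show ?thesis
    unfolding C1c_def
  proof (intro conjI ballI)
    show "C0c (?e \<psi>)"
      using differentiable_imp_continuous_on[OF C(1)] K(3) by (rule C0c)
    show "C0c (?e (partial_x S \<psi>))" "C0c (?e (partial_t S \<psi>))"
      using C(2,3) zero by (auto intro: C0c)
    fix z assume z: "z \<in> closed_half_plane"
    show "(?e \<psi> has_derivative (\<lambda>h. fst h * ?e (partial_x S \<psi>) z + snd h * ?e (partial_t S \<psi>) z))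
       (at z within closed_half_plane)"
    proof (cases "z \<in> S")
      case False
      then show ?thesis using D0[OF z] K(2) by auto
    qed (use D1[of z] in simp)
  qed
qed


section \<open>The travelling step and its averaged value\<close>

text \<open>
  The time derivative follows from the space derivative because the step is transported with
  speed \<open>c\<close>: \<open>v\<^sub>t = - c v\<^sub>x\<close>, there being no initial term for test functions that vanish near
  \<open>t = 0\<close>.
\<close>
lemma step_derivative_measures:
  shows "is_measure_x (step a b c) (signed_ray c (- b))"
    and "is_measure_t (step a b c) (signed_ray c (c * b))"
proof -
  have "(LINT z:half_plane|lborel. step a b c z * partial_x half_plane \<psi> z) =
        - signed_integral (signed_ray c (- b)) \<psi>"
    "(LINT z:half_plane|lborel. step a b c z * partial_t half_plane \<psi> z) =
        - signed_integral (signed_ray c (c * b)) \<psi>"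
    if \<psi>: "\<psi> \<in> test_functions half_plane" for \<psi>
  proof -
    define \<theta> p q where "\<theta> = (\<lambda>z. if z \<in> half_plane then \<psi> z else 0)"
      and "p = (\<lambda>z. if z \<in> half_plane then partial_x half_plane \<psi> z else 0)"
      and "q = (\<lambda>z. if z \<in> half_plane then partial_t half_plane \<psi> z else 0)"
    have D: "C1c \<theta> p q"
      using test_function_C1c[OF _ \<psi>] by (simp add: \<theta>_def p_def q_def)
    then have C0c: "C0c \<theta>" "C0c p" "C0c q" by (auto simp: C1c_def)
    let ?I = "LINT t:{0<..}|lborel. \<theta> (c * t, t)"
    have \<psi>_eq: "signed_integral (signed_ray c k) \<psi> = k * ?I" for k
    proof -
      have "signed_integral M \<psi> = signed_integral M (\<lambda>z. 1 * \<theta> z)" for M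
        unfolding signed_integral_def set_lebesgue_integral_def
        by (auto simp: \<theta>_def indicator_def
            intro!: arg_cong2[where f = "(-)"] Bochner_Integration.integral_cong)
      then show ?thesis using signed_ray_integral(2)[OF C0c(1), of "\<lambda>_. 1" c 1 k] by simp
    qed
    have x: "(LINT z:half_plane|lborel. step a b c z * p z) = b * ?I"
      by (rule integral_step_x[OF D])
    have "(LINT z:half_plane|lborel. step a b c z * (q z + c * p z)) = 0"
      using integral_step_transport(2)[OF D, of a b c] by (simp add: \<theta>_def)
    then have "(LINT z:half_plane|lborel. step a b c z * q z + c * (step a b c z * p z)) = 0"
      by (simp add: algebra_simps)
    then have t: "(LINT z:half_plane|lborel. step a b c z * q z) = - (c * b) * ?I"
      using x step_integrable[OF C0c(2), of a b c] step_integrable[OF C0c(3), of a b c]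
      by (simp add: set_integral_add(2))
    have "(LINT z:half_plane|lborel. step a b c z * partial_x half_plane \<psi> z) =
        (LINT z:half_plane|lborel. step a b c z * p z)"
      "(LINT z:half_plane|lborel. step a b c z * partial_t half_plane \<psi> z) =
        (LINT z:half_plane|lborel. step a b c z * q z)"
      unfolding set_lebesgue_integral_def
      by (auto simp: p_def q_def indicator_def intro!: Bochner_Integration.integral_cong)
    then show "(LINT z:half_plane|lborel. step a b c z * partial_x half_plane \<psi> z) =
        - signed_integral (signed_ray c (- b)) \<psi>"
      "(LINT z:half_plane|lborel. step a b c z * partial_t half_plane \<psi> z) =
        - signed_integral (signed_ray c (c * b)) \<psi>"
      using x t by (simp_all add: \<psi>_eq)
  qed
  then show "is_measure_x (step a b c) (signed_ray c (- b))"
    "is_measure_t (step a b c) (signed_ray c (c * b))"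
    by (auto simp: derivative_measure_def signed_radon_ray)
qed

lemma BV_loc_step: "BV_loc (step a b c)"
proof -
  have "set_integrable lborel (half_plane \<inter> K) (step a b c)" if K: "compact K" for K
    unfolding set_integrable_def
  proof (rule integrableI_bounded_set[where A = "half_plane \<inter> K" and B = "\<bar>a\<bar> + \<bar>b\<bar>"])
    have [measurable]: "K \<in> sets borel" using K by (rule borel_compact)
    show "half_plane \<inter> K \<in> sets lborel" by simp
    show "(\<lambda>z. indicator (half_plane \<inter> K) z *\<^sub>R step a b c z) \<in> borel_measurable lborel"
      by measurable
    have "bounded (half_plane \<inter> K)" using compact_imp_bounded[OF K] by (rule bounded_subset) auto
    then show "emeasure lborel (half_plane \<inter> K) < \<infinity>" by (rule emeasure_bounded_finite)
  qed (auto simp: abs_step_le indicator_def)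
  then show ?thesis
    using step_derivative_measures unfolding BV_loc_def loc_integrable_def by blast
qed

text \<open>
  The partial derivatives of a function affine in time are constants, hence again affine in
  time, so the class is closed under the recursion that defines smoothness.
\<close>
lemma smooth_on_time_affine:
  assumes "\<And>z. z \<in> closed_half_plane \<Longrightarrow> f z = k * snd z + m"
  shows "smooth_on closed_half_plane f"
proof -
  have "Ck_on n closed_half_plane f" if "\<forall>z \<in> closed_half_plane. f z = k * snd z + m" for n f k m
    using that
  proof (induction n arbitrary: f k m)
    case 0
    have "continuous_on closed_half_plane (\<lambda>z. k * snd z + m)" by (intro continuous_intros)
    then show ?case using 0 by (auto cong: continuous_on_cong)
  next
    case (Suc n)
    have D: "(f has_derivative (\<lambda>h. k * snd h)) (at z within closed_half_plane)"
      if z: "z \<in> closed_half_plane" for z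
    proof (rule has_derivative_transform[OF z])
      show "((\<lambda>z. k * snd z + m) has_derivative (\<lambda>h. k * snd h)) (at z within closed_half_plane)"
        by (auto intro!: derivative_eq_intros)
    qed (use Suc.prems in simp)
    have F: "frechet_derivative f (at z within closed_half_plane) = (\<lambda>h. k * snd h)"
      if z: "z \<in> closed_half_plane" for z
      using has_derivative_unique_closed_half_plane[OF z _ D[OF z]] D[OF z]
        frechet_derivative_works[of f] differentiableI by blast
    have "Ck_on n closed_half_plane (partial_x closed_half_plane f)"
      by (rule Suc.IH[of _ 0 0]) (simp add: partial_def F)
    moreover have "Ck_on n closed_half_plane (partial_t closed_half_plane f)"
      by (rule Suc.IH[of _ 0 k]) (simp add: partial_def F)
    ultimately show ?case
      using D by (auto simp: differentiable_on_def differentiable_def)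
  qed
  then show ?thesis using assms unfolding smooth_on_def by blast
qed

lemma step_side_limits:
  "((\<lambda>y. step a b c (y, t)) \<longlongrightarrow> (if x \<le> c * t then a + b else a)) (at_left x)"
  "((\<lambda>y. step a b c (y, t)) \<longlongrightarrow> (if x < c * t then a + b else a)) (at_right x)"
proof -
  have 1: "\<forall>\<^sub>F y in at x within S. y < c * t" if "x < c * t" for S
    using order_tendstoD(2)[OF tendsto_ident_at that] .
  have 2: "\<forall>\<^sub>F y in at x within S. c * t < y" if "c * t < x" for S
    using order_tendstoD(1)[OF tendsto_ident_at that] .
  have 3: "\<forall>\<^sub>F y in at_left x. y < x" "\<forall>\<^sub>F y in at_right x. x < y"
    by (simp_all add: eventually_at_filter)
  show "((\<lambda>y. step a b c (y, t)) \<longlongrightarrow> (if x \<le> c * t then a + b else a)) (at_left x)"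
  proof (rule tendsto_eventually, cases "x \<le> c * t")
    case True
    show "\<forall>\<^sub>F y in at_left x. step a b c (y, t) = (if x \<le> c * t then a + b else a)"
      using 3(1) by eventually_elim (use True in \<open>simp add: step_def heaviside_def\<close>)
  next
    case False
    then have "c * t < x" by simp
    from 2[OF this] show "\<forall>\<^sub>F y in at_left x. step a b c (y, t) = (if x \<le> c * t then a + b else a)"
      by eventually_elim (use False in \<open>simp add: step_def heaviside_def\<close>)
  qed
  show "((\<lambda>y. step a b c (y, t)) \<longlongrightarrow> (if x < c * t then a + b else a)) (at_right x)"
  proof (rule tendsto_eventually, cases "x < c * t")
    case True
    from 1[OF this] show "\<forall>\<^sub>F y in at_right x. step a b c (y, t) = (if x < c * t then a + b else a)"
      by eventually_elim (use True in \<open>simp add: step_def heaviside_def\<close>)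
  next
    case False
    show "\<forall>\<^sub>F y in at_right x. step a b c (y, t) = (if x < c * t then a + b else a)"
      using 3(2) by eventually_elim (use False in \<open>simp add: step_def heaviside_def\<close>)
  qed
qed

lemma has_side_limits_step: "has_side_limits (step a b c) z"
  unfolding has_side_limits_def using step_side_limits by blast

text \<open>
  The average over the segment joining the one-sided limits is their arithmetic mean; writing it
  with \<open>sgn\<close> covers both sides of the shock (value \<open>a + b\<close> or \<open>a\<close>) and the shock itself (value
  \<open>a + b / 2\<close>) at once, and makes it visibly measurable.
\<close>
lemma hat_step: "hat (step a b c) z = a + b * (1 + sgn (c * snd z - fst z)) / 2"
proof (cases z)
  case (Pair x t)
  have l: "Lim (at_left x) (\<lambda>y. step a b c (y, t)) = (if x \<le> c * t then a + b else a)"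
    by (rule tendsto_Lim[OF _ step_side_limits(1)]) simp
  have r: "Lim (at_right x) (\<lambda>y. step a b c (y, t)) = (if x < c * t then a + b else a)"
    by (rule tendsto_Lim[OF _ step_side_limits(2)]) simp
  have mean: "integral {0..1} (\<lambda>\<tau>. l + \<tau> * (r - l)) = (l + r) / 2" for l r :: real
  proof -
    have "((\<lambda>\<tau>. l + \<tau> * (r - l)) has_integral (l * 1 + 1\<^sup>2 / 2 * (r - l)) - (l * 0 + 0\<^sup>2 / 2 * (r - l))) {0..1}"
      by (rule fundamental_theorem_of_calculus)
        (auto intro!: derivative_eq_intros
          simp flip: has_real_derivative_iff_has_vector_derivative)
    then show ?thesis by (simp add: integral_unique field_simps)
  qed
  have "hat (step a b c) z =
      ((if x \<le> c * t then a + b else a) + (if x < c * t then a + b else a)) / 2"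
    by (simp only: hat_def Pair fst_conv snd_conv l r mean Let_def)
  then show ?thesis
    by (cases x "c * t" rule: linorder_cases) (simp_all add: Pair add_divide_distrib)
qed

lemma measurable_hat_step: "hat (step a b c) \<in> borel_measurable borel"
proof -
  have [measurable]: "(\<lambda>z. c * snd z - fst z :: real) \<in> borel_measurable borel"
    by (intro borel_measurable_continuous_onI continuous_intros)
  show ?thesis unfolding hat_step[abs_def] by measurable
qed


section \<open>The delta shock\<close>

lemma deriv_along_ray:
  assumes "C1c \<theta> p q" "0 < t"
  shows "deriv (along (\<lambda>t. c * t) \<theta>) t = q (c * t, t) + c * p (c * t, t)"
proof -
  have "((\<lambda>t. \<theta> (c * t, t)) has_real_derivative q (c * t, t) + c * p (c * t, t)) (at t within {0..})"
    using C1c_slices(2)[OF C1c_shear[OF assms(1), of c] less_imp_le[OF assms(2)], of 0]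
    by (simp only: shear_def fst_conv snd_conv add_0)
  moreover have "at t within {0..} = at t"
    by (rule at_within_interior) (use assms(2) in simp)
  ultimately have "((\<lambda>t. \<theta> (c * t, t)) has_real_derivative q (c * t, t) + c * p (c * t, t)) (at t)"
    by simp
  then show ?thesis by (simp add: along_def[abs_def] DERIV_imp_deriv)
qed

theorem theorem3p6:
  fixes u0 u1 s0 s1 :: real
  assumes "u1 \<noteq> 0"
  shows "\<exists>(u :: real \<times> real \<Rightarrow> real) (s :: real \<times> real \<Rightarrow> real)
            (e :: real \<times> real \<Rightarrow> real) (\<phi> :: real \<Rightarrow> real).
      (\<forall>t. \<phi> t = (jump ((u0 + u1)\<^sup>2 / 2) (u0\<^sup>2 / 2) - jump (s0 + s1) s0) / jump (u0 + u1) u0 * t) \<and>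
      (\<forall>x t. e (x, t) = (jump (s0 + s1) s0)\<^sup>2 / jump (u0 + u1) u0 * t) \<and>
      (\<forall>x t. u (x, t) = u0 + u1 * heaviside (- x + \<phi> t)) \<and>
      (\<forall>x t. s (x, t) = s0 + s1 * heaviside (- x + \<phi> t)) \<and>
      delta_shock_solution u s e \<phi> (\<lambda>x. u0 + u1 * heaviside (- x)) \<and>
      (\<forall>x. u (x, 0) = u0 + u1 * heaviside (- x)) \<and>
      (\<forall>x. s (x, 0) = s0 + s1 * heaviside (- x)) \<and>
      (\<forall>x. e (x, 0) = 0)"
proof -
  define c where "c = (jump ((u0 + u1)\<^sup>2 / 2) (u0\<^sup>2 / 2) - jump (s0 + s1) s0) / jump (u0 + u1) u0"
  define k where "k = (jump (s0 + s1) s0)\<^sup>2 / jump (u0 + u1) u0"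
  define u where "u = step u0 u1 c"
  define s where "s = step s0 s1 c"
  define e where "e = (\<lambda>z :: real \<times> real. k * snd z)"
  define \<phi> where "\<phi> = (\<lambda>t. c * t)"
  \<comment> \<open>The Rankine-Hugoniot condition: \<open>c [u]\<close> is the jump of the flux \<open>u\<^sup>2 / 2 - s\<close>.\<close>
  have c: "c * u1 = u0 * u1 + u1\<^sup>2 / 2 - s1"
    using assms by (simp add: c_def jump_def field_simps power2_eq_square)
  \<comment> \<open>The growth rate is \<open>[\<sigma>]\<close> times the excess of the averaged velocity over the shock speed.\<close>
  have k: "k = - (s1 * (c - (u0 + u1 / 2)))"
    using assms by (simp add: k_def c_def jump_def field_simps power2_eq_square)
  \<comment> \<open>The value that \<open>(u\<^sup>2 / 2 - s) - c u\<close> takes ahead of the shock, and by the choice of \<open>c\<close> also behind it.\<close>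
  define m where "m = u0\<^sup>2 / 2 - s0 - c * u0"
  have flux: "(u z)\<^sup>2 / 2 - s z = c * u z + m" for z
  proof (cases "0 \<le> - fst z + c * snd z")
    case True
    then have "u z = u0 + u1" "s z = s0 + s1" by (simp_all add: u_def s_def step_def heaviside_def)
    then show ?thesis using c by (simp add: m_def power2_eq_square algebra_simps)
  next
    case False
    then have "u z = u0" "s z = s0" by (simp_all add: u_def s_def step_def heaviside_def)
    then show ?thesis by (simp add: m_def)
  qed
  \<comment> \<open>A constant is a step of height zero, so that \<open>integral_step_x\<close> applies to the term \<open>m \<theta>\<^sub>x\<close>.\<close>
  have m_step: "step m 0 c z = m" for z by (simp add: step_def)
  have Mx: "is_measure_x s (signed_ray c (- s1))" and Mt: "is_measure_t s (signed_ray c (c * s1))"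
    unfolding s_def by (rule step_derivative_measures)+
  have momentum: "set_integrable lborel half_plane
          (\<lambda>z. u z * partial_t closed_half_plane \<theta> z
             + ((u z)\<^sup>2 / 2 - s z) * partial_x closed_half_plane \<theta> z) \<and>
        integrable lborel (\<lambda>x. (u0 + u1 * heaviside (- x)) * \<theta> (x, 0)) \<and>
        (LINT z:half_plane|lborel.
            u z * partial_t closed_half_plane \<theta> z
             + ((u z)\<^sup>2 / 2 - s z) * partial_x closed_half_plane \<theta> z)
          + (LINT x|lborel. (u0 + u1 * heaviside (- x)) * \<theta> (x, 0)) = 0"
    and transport: "signed_integrable (signed_ray c (c * s1)) \<theta> \<and>
           signed_integrable (signed_ray c (- s1)) (\<lambda>z. hat u z * \<theta> z) \<and>
           set_integrable lborel {0<..} (\<lambda>t. along \<phi> e t * deriv (along \<phi> \<theta>) t) \<and>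
           signed_integral (signed_ray c (c * s1)) \<theta>
             + signed_integral (signed_ray c (- s1)) (\<lambda>z. hat u z * \<theta> z)
             - (LINT t:{0<..}|lborel. along \<phi> e t * deriv (along \<phi> \<theta>) t) = 0"
    if \<theta>: "\<theta> \<in> test_functions closed_half_plane" for \<theta>
  proof -
    define \<theta>' p q where "\<theta>' = (\<lambda>z. if z \<in> closed_half_plane then \<theta> z else 0)"
      and "p = (\<lambda>z. if z \<in> closed_half_plane then partial_x closed_half_plane \<theta> z else 0)"
      and "q = (\<lambda>z. if z \<in> closed_half_plane then partial_t closed_half_plane \<theta> z else 0)"
    have D: "C1c \<theta>' p q"
      using test_function_C1c[OF _ \<theta>] by (simp add: \<theta>'_def p_def q_def)
    then have C0c: "C0c \<theta>'" "C0c p" "C0c q" by (auto simp: C1c_def)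
    have eq: "\<theta>' z = \<theta> z" "p z = partial_x closed_half_plane \<theta> z"
      "q z = partial_t closed_half_plane \<theta> z" if "z \<in> half_plane" for z
      using that half_plane_subset by (auto simp: \<theta>'_def p_def q_def)
    have \<theta>0: "\<theta>' (x, 0) = \<theta> (x, 0)" for x by (simp add: \<theta>'_def)

    let ?F = "\<lambda>z. u z * partial_t closed_half_plane \<theta> z
        + ((u z)\<^sup>2 / 2 - s z) * partial_x closed_half_plane \<theta> z"
    let ?G = "\<lambda>z. step u0 u1 c z * (q z + c * p z)"
    let ?H = "\<lambda>z. step m 0 c z * p z"
    have F: "?F z = ?G z + ?H z" if "z \<in> half_plane" for z
      unfolding flux m_step eq[OF that] u_def[symmetric] by (simp add: algebra_simps)
    have G: "set_integrable lborel half_plane ?G" and H: "set_integrable lborel half_plane ?H"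
      by (intro step_integrable C0c_add C0c_cmult C0c)+
    have "set_integrable lborel half_plane ?F \<longleftrightarrow> set_integrable lborel half_plane (\<lambda>z. ?G z + ?H z)"
      by (intro set_integrable_cong refl F)
    moreover have "(LINT z:half_plane|lborel. ?F z) = (LINT z:half_plane|lborel. ?G z + ?H z)"
      by (intro set_lebesgue_integral_cong) (auto simp: F)
    moreover note set_integral_add[OF G H] integral_step_transport[OF D, of u0 u1]
      integral_step_x[OF D, of m 0 c]
    ultimately show "set_integrable lborel half_plane ?F \<and>
        integrable lborel (\<lambda>x. (u0 + u1 * heaviside (- x)) * \<theta> (x, 0)) \<and>
        (LINT z:half_plane|lborel. ?F z)
          + (LINT x|lborel. (u0 + u1 * heaviside (- x)) * \<theta> (x, 0)) = 0"
      by (simp add: \<theta>0)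

    let ?I = "LINT t:{0<..}|lborel. \<theta>' (c * t, t)"
    have cong: "signed_integrable M (\<lambda>z. w z * \<theta> z) = signed_integrable M (\<lambda>z. w z * \<theta>' z)"
      "signed_integral M (\<lambda>z. w z * \<theta> z) = signed_integral M (\<lambda>z. w z * \<theta>' z)" for M w
      unfolding signed_integrable_def signed_integral_def set_integrable_def set_lebesgue_integral_def
      by (auto simp: eq indicator_def intro!: arg_cong2[where f = "(-)"] arg_cong2[where f = "(\<and>)"]
          Bochner_Integration.integral_cong Bochner_Integration.integrable_cong)
    have A: "signed_integrable (signed_ray c (c * s1)) \<theta>"
      "signed_integral (signed_ray c (c * s1)) \<theta> = c * s1 * ?I"
      using signed_ray_integral[OF C0c(1), of "\<lambda>_. 1" c 1 "c * s1"] cong[of _ "\<lambda>_. 1"] by simp_all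
    have hat: "hat u (c * t, t) = u0 + u1 / 2" for t by (simp add: u_def hat_step)
    have hm: "hat u \<in> borel_measurable borel" unfolding u_def by (rule measurable_hat_step)
    have B: "signed_integrable (signed_ray c (- s1)) (\<lambda>z. hat u z * \<theta> z)"
      "signed_integral (signed_ray c (- s1)) (\<lambda>z. hat u z * \<theta> z) = - s1 * ((u0 + u1 / 2) * ?I)"
      using signed_ray_integral[OF C0c(1) hm hat] by (simp_all only: cong)
    let ?E = "\<lambda>t. along \<phi> e t * deriv (along \<phi> \<theta>) t"
    let ?W = "\<lambda>t. k * (t * (q (c * t, t) + c * p (c * t, t)))"
    have E: "?E t = ?W t" if t: "t \<in> {0<..}" for t
    proof -
      \<comment> \<open>\<open>\<theta>\<close> and \<open>\<theta>'\<close> may differ at negative times, but \<open>deriv\<close> only sees times near \<open>t > 0\<close>.\<close>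
      have "\<forall>\<^sub>F r in nhds t. r \<in> {0<..}"
        using t by (intro eventually_nhds_in_open) auto
      then have "\<forall>\<^sub>F r in nhds t. along \<phi> \<theta> r = along \<phi> \<theta>' r"
        by eventually_elim (simp add: along_def \<theta>'_def)
      then have "deriv (along \<phi> \<theta>) t = deriv (along \<phi> \<theta>') t"
        by (rule deriv_cong_ev) simp
      also have "\<dots> = q (c * t, t) + c * p (c * t, t)"
        unfolding \<phi>_def using t by (intro deriv_along_ray[OF D]) simp
      finally show ?thesis by (simp add: along_def e_def)
    qed
    note W = integral_time_weighted[OF D, of c]
    have "set_integrable lborel {0<..} ?E \<longleftrightarrow> set_integrable lborel {0<..} ?W"
      by (intro set_integrable_cong refl E)
    moreover have "(LINT t:{0<..}|lborel. ?E t) = (LINT t:{0<..}|lborel. ?W t)"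
      by (intro set_lebesgue_integral_cong) (auto simp: E)
    ultimately have C: "set_integrable lborel {0<..} ?E" "(LINT t:{0<..}|lborel. ?E t) = - k * ?I"
      using W by simp_all
    have "c * s1 * ?I + - s1 * ((u0 + u1 / 2) * ?I) - - k * ?I = 0"
      unfolding k by (simp add: algebra_simps)
    then show "signed_integrable (signed_ray c (c * s1)) \<theta> \<and>
           signed_integrable (signed_ray c (- s1)) (\<lambda>z. hat u z * \<theta> z) \<and>
           set_integrable lborel {0<..} ?E \<and>
           signed_integral (signed_ray c (c * s1)) \<theta>
             + signed_integral (signed_ray c (- s1)) (\<lambda>z. hat u z * \<theta> z)
             - (LINT t:{0<..}|lborel. ?E t) = 0"
      using A B C by simp
  qed
  have "C1_curve \<phi>"
    unfolding C1_curve_def \<phi>_def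
    by (intro exI[of _ "\<lambda>_. c"]) (auto intro!: derivative_eq_intros continuous_intros)
  moreover have "smooth_on closed_half_plane e"
    by (rule smooth_on_time_affine[of _ k 0]) (simp add: e_def)
  moreover have "BV_loc u" "BV_loc s" unfolding u_def s_def by (rule BV_loc_step)+
  moreover have "signed_AE (signed_ray c (- s1)) (has_side_limits u)"
    by (simp add: signed_AE_def u_def has_side_limits_step)
  ultimately have "delta_shock_solution u s e \<phi> (\<lambda>x. u0 + u1 * heaviside (- x))"
    unfolding delta_shock_solution_def using Mx Mt momentum transport by blast
  then show ?thesis
    by (intro exI[of _ u] exI[of _ s] exI[of _ e] exI[of _ \<phi>])
      (simp add: \<phi>_def e_def u_def s_def step_def c_def k_def)
qed

end
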